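(* Let $G$ be a compact group with a compatible bi-invariant metric $d$. Suppose $G=1_1$ and $1_\eta$ is a subgroup of $G$ for all $\eta\in(0,1]$. Let $L\ge1$. If $G$ is $L$-locally random with coefficient $C_0$, then $G$ is $(C_0,L)$-metric quasi-random. Conversely, if $G$ is $(C,L)$-metric quasi-random, then $G$ is $L$-locally random with coefficient $2C$.
   Context: $1_\eta$ is the open $d$-ball of radius $\eta$ about the identity. $\widehat G$ is the set of equivalence classes of irreducible unitary representations of $G$. $(G,d)$ is $L$-locally random with coefficient $C_0>0$ if $\|\pi(x)-\pi(y)\|_{\mathrm{op}}\le C_0(\dim\pi)^Ld(x,y)$ for every $\pi\in\widehat G$ and all $x,y\in G$. The level of $\pi\in\widehat G$ is $\ell(\pi)=\inf\{\eta^{-1}:\eta>0,\ 1_\eta\subseteq\ker\pi\}$ (with $\inf\emptyset=+\infty$; thus $\ell(\pi)=0$ for trivial $\pi$). A compact group $G$ with a given bi-invariant metric is $(C,A)$-metric quasi-random ($C, A>0$) if (1) $1_\eta$ is a subgroup of $G$ for all $\eta>0$, and (2) $\ell(\pi)\le C(\dim\pi)^A$ for all $\pi\in\widehat G$. *)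

theory Defs
  imports
    "HOL-Analysis.Abstract_Metric_Spaces"
    "HOL-Library.Extended_Real"
    "HOL-Algebra.Coset"
    "Jordan_Normal_Form.Schur_Decomposition"
    "Jordan_Normal_Form.VS_Connect"
begin

definition topological_group :: "('a, 'b) monoid_scheme \<Rightarrow> 'a topology \<Rightarrow> bool" where
  "topological_group G T \<longleftrightarrow>
     group G \<and> topspace T = carrier G \<and>
     continuous_map (prod_topology T T) T (\<lambda>(x, y). x \<otimes>\<^bsub>G\<^esub> y) \<and>
     continuous_map T T (\<lambda>x. m_inv G x)"

definition compact_group :: "('a, 'b) monoid_scheme \<Rightarrow> 'a topology \<Rightarrow> bool" where
  "compact_group G T \<longleftrightarrow> topological_group G T \<and> compact_space T \<and> Hausdorff_space T"

definition compatible_metric ::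
  "('a, 'b) monoid_scheme \<Rightarrow> 'a topology \<Rightarrow> ('a \<Rightarrow> 'a \<Rightarrow> real) \<Rightarrow> bool" where
  "compatible_metric G T d \<longleftrightarrow>
     Metric_space (carrier G) d \<and> Metric_space.mtopology (carrier G) d = T"

definition bi_invariant ::
  "('a, 'b) monoid_scheme \<Rightarrow> ('a \<Rightarrow> 'a \<Rightarrow> real) \<Rightarrow> bool" where
  "bi_invariant G d \<longleftrightarrow>
     (\<forall>g\<in>carrier G. \<forall>x\<in>carrier G. \<forall>y\<in>carrier G.
        d (g \<otimes>\<^bsub>G\<^esub> x) (g \<otimes>\<^bsub>G\<^esub> y) = d x y \<and> d (x \<otimes>\<^bsub>G\<^esub> g) (y \<otimes>\<^bsub>G\<^esub> g) = d x y)"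

definition one_ball ::
  "('a, 'b) monoid_scheme \<Rightarrow> ('a \<Rightarrow> 'a \<Rightarrow> real) \<Rightarrow> real \<Rightarrow> 'a set" where
  "one_ball G d \<eta> = Metric_space.mball (carrier G) d \<one>\<^bsub>G\<^esub> \<eta>"

definition unitary_mat :: "nat \<Rightarrow> complex mat \<Rightarrow> bool" where
  "unitary_mat n U \<longleftrightarrow>
     U \<in> carrier_mat n n \<and> U * mat_adjoint U = 1\<^sub>m n \<and> mat_adjoint U * U = 1\<^sub>m n"

text \<open>
  Irreducible unitary representations of a compact group are finite-dimensional, so, after the choice
  of an orthonormal basis, an element of the unitary dual is represented by a continuous homomorphism
  into the unitary \<open>n \<times> n\<close> matrices, where \<open>n\<close> is its dimension.  Everything below is invariant under
  unitary equivalence, hence quantifying over the unitary dual amounts to quantifying over all pairs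
  \<open>n\<close>, \<open>\<pi>\<close> satisfying \<open>irreducible_unitary_rep\<close>.  The values of \<open>\<pi>\<close> outside the
  carrier are irrelevant.
\<close>

definition unitary_rep ::
  "('a, 'b) monoid_scheme \<Rightarrow> 'a topology \<Rightarrow> nat \<Rightarrow> ('a \<Rightarrow> complex mat) \<Rightarrow> bool" where
  "unitary_rep G T n \<pi> \<longleftrightarrow>
     (\<forall>x\<in>carrier G. unitary_mat n (\<pi> x)) \<and>
     (\<forall>x\<in>carrier G. \<forall>y\<in>carrier G. \<pi> (x \<otimes>\<^bsub>G\<^esub> y) = \<pi> x * \<pi> y) \<and>
     (\<forall>i<n. \<forall>j<n. continuous_map T euclidean (\<lambda>x. \<pi> x $$ (i, j)))"

definition invariant_subspace ::
  "('a, 'b) monoid_scheme \<Rightarrow> nat \<Rightarrow> ('a \<Rightarrow> complex mat) \<Rightarrow> complex vec set \<Rightarrow> bool" where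
  "invariant_subspace G n \<pi> W \<longleftrightarrow>
     VectorSpace.subspace class_ring W (module_vec TYPE(complex) n) \<and>
     (\<forall>x\<in>carrier G. \<forall>w\<in>W. \<pi> x *\<^sub>v w \<in> W)"

definition irreducible_unitary_rep ::
  "('a, 'b) monoid_scheme \<Rightarrow> 'a topology \<Rightarrow> nat \<Rightarrow> ('a \<Rightarrow> complex mat) \<Rightarrow> bool" where
  "irreducible_unitary_rep G T n \<pi> \<longleftrightarrow>
     unitary_rep G T n \<pi> \<and> n > 0 \<and>
     (\<forall>W. invariant_subspace G n \<pi> W \<longrightarrow> W = {0\<^sub>v n} \<or> W = carrier_vec n)"

definition rep_kernel ::
  "('a, 'b) monoid_scheme \<Rightarrow> nat \<Rightarrow> ('a \<Rightarrow> complex mat) \<Rightarrow> 'a set" where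
  "rep_kernel G n \<pi> = {x \<in> carrier G. \<pi> x = 1\<^sub>m n}"

definition vec_norm :: "complex vec \<Rightarrow> real" where
  "vec_norm v = sqrt (Re (v \<bullet>c v))"

definition op_norm :: "complex mat \<Rightarrow> real" where
  "op_norm A = (SUP v\<in>{v \<in> carrier_vec (dim_col A). vec_norm v \<le> 1}. vec_norm (A *\<^sub>v v))"

definition locally_random ::
  "('a, 'b) monoid_scheme \<Rightarrow> 'a topology \<Rightarrow> ('a \<Rightarrow> 'a \<Rightarrow> real) \<Rightarrow> real \<Rightarrow> real \<Rightarrow> bool" where
  "locally_random G T d L C\<^sub>0 \<longleftrightarrow>
     C\<^sub>0 > 0 \<and>
     (\<forall>n \<pi>. irreducible_unitary_rep G T n \<pi> \<longrightarrow>
        (\<forall>x\<in>carrier G. \<forall>y\<in>carrier G.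
           op_norm (\<pi> x - \<pi> y) \<le> C\<^sub>0 * real n powr L * d x y))"

text \<open>In \<open>ereal\<close> the infimum of the empty set is \<open>\<infinity>\<close>.\<close>

definition rep_level ::
  "('a, 'b) monoid_scheme \<Rightarrow> ('a \<Rightarrow> 'a \<Rightarrow> real) \<Rightarrow> nat \<Rightarrow> ('a \<Rightarrow> complex mat) \<Rightarrow> ereal" where
  "rep_level G d n \<pi> = Inf {ereal (inverse \<eta>) | \<eta>. \<eta> > 0 \<and> one_ball G d \<eta> \<subseteq> rep_kernel G n \<pi>}"

definition metric_quasi_random ::
  "('a, 'b) monoid_scheme \<Rightarrow> 'a topology \<Rightarrow> ('a \<Rightarrow> 'a \<Rightarrow> real) \<Rightarrow> real \<Rightarrow> real \<Rightarrow> bool" where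
  "metric_quasi_random G T d C A \<longleftrightarrow>
     C > 0 \<and> A > 0 \<and>
     (\<forall>\<eta>>0. subgroup (one_ball G d \<eta>) G) \<and>
     (\<forall>n \<pi>. irreducible_unitary_rep G T n \<pi> \<longrightarrow>
        rep_level G d n \<pi> \<le> ereal (C * real n powr A))"

end

theory Submission
  imports Defs
begin

text \<open>
  Both implications compare the ball \<open>1\<^sub>\<eta>\<close> with the kernel of \<open>\<pi>\<close>. Write \<open>K = C n\<^sup>L\<close>, where
  \<open>n\<close> is the dimension of \<open>\<pi>\<close>.

  Suppose that \<open>\<pi>\<close> is Lipschitz with constant \<open>K\<close>. Every element of the subgroup \<open>1\<^sub>\<eta>\<close> with
  \<open>\<eta> = 1/K\<close> is then mapped to distance at most \<open>1\<close> from the identity matrix. The unitary group has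
  no nontrivial subgroup that close to the identity, so \<open>1\<^sub>\<eta>\<close> lies in the kernel and the level of
  \<open>\<pi>\<close> is at most \<open>K\<close>. Here \<open>\<eta>\<close> may exceed \<open>1\<close>, but then \<open>1\<^sub>\<eta>\<close> is all of \<open>G\<close>, because
  \<open>G = 1\<^sub>1\<close>.

  The absence of small subgroups (\<open>unitary_squaring_orbit_near_one\<close>) is shown without
  eigenvalues. If a unitary \<open>U\<close> has distance at most \<open>1\<close> from the identity, the parallelogram law
  gives \<open>|(U\<^sup>2 - 1)v| \<ge> \<surd>3 |(U - 1)v|\<close> for each vector \<open>v\<close>. Under repeated squaring inside the
  subgroup, a nonzero displacement of \<open>v\<close> would therefore grow geometrically, although it never
  exceeds \<open>|v|\<close>.

  Conversely, suppose that the level of \<open>\<pi>\<close> is at most \<open>K\<close>. If \<open>d(x,y) < 1/K\<close>, then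
  bi-invariance puts \<open>x y\<^sup>-\<^sup>1\<close> into a ball contained in the kernel, and \<open>\<pi>(x) = \<pi>(y)\<close>. Otherwise
  \<open>2 \<le> 2 K d(x,y)\<close>, and any two unitary matrices are at distance at most \<open>2\<close>. This is where the
  factor \<open>2\<close> in the coefficient comes from.
\<close>

section \<open>The Euclidean norm of complex vectors\<close>

lemma vec_norm_eq_sqrt_sum: "vec_norm v = sqrt (\<Sum>i<dim_vec v. (cmod (v $ i))\<^sup>2)"
proof -
  have "v \<bullet>c v = complex_of_real (\<Sum>i<dim_vec v. (cmod (v $ i))\<^sup>2)"
    by (simp add: scalar_prod_def complex_norm_square lessThan_atLeast0 del: of_real_power)
  then show ?thesis
    by (simp add: vec_norm_def)
qed

lemma vec_norm_power2: "(vec_norm v)\<^sup>2 = (\<Sum>i<dim_vec v. (cmod (v $ i))\<^sup>2)"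
  by (simp add: vec_norm_eq_sqrt_sum sum_nonneg)

lemma vec_norm_nonneg: "0 \<le> vec_norm v"
  by (simp add: vec_norm_eq_sqrt_sum sum_nonneg)

lemma vec_norm_zero: "vec_norm (0\<^sub>v n) = 0"
  by (simp add: vec_norm_def)

lemma vec_norm_eq_0_iff:
  assumes "v \<in> carrier_vec n"
  shows "vec_norm v = 0 \<longleftrightarrow> v = 0\<^sub>v n"
proof
  assume "vec_norm v = 0"
  then have "(\<Sum>i<dim_vec v. (cmod (v $ i))\<^sup>2) = 0"
    by (simp flip: vec_norm_power2)
  then have "v $ i = 0" if "i < n" for i
    using that assms by (subst (asm) sum_nonneg_eq_0_iff) auto
  then show "v = 0\<^sub>v n"
    using assms by (intro eq_vecI) auto
qed (simp add: vec_norm_zero)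

lemma vec_norm_smult: "vec_norm (c \<cdot>\<^sub>v v) = cmod c * vec_norm v"
proof -
  have "(vec_norm (c \<cdot>\<^sub>v v))\<^sup>2 = (cmod c * vec_norm v)\<^sup>2"
    by (simp add: vec_norm_power2 power_mult_distrib norm_mult sum_distrib_left)
  then show ?thesis
    by (rule power2_eq_imp_eq) (simp_all add: vec_norm_nonneg)
qed

text \<open>
  This identity replaces the triangle inequality below, and it gives lower bounds as well, which the
  growth of displacements under squaring rests on.
\<close>

lemma vec_parallelogram:
  assumes "v \<in> carrier_vec n" "w \<in> carrier_vec n"
  shows "(vec_norm (v + w))\<^sup>2 + (vec_norm (v - w))\<^sup>2 = 2 * (vec_norm v)\<^sup>2 + 2 * (vec_norm w)\<^sup>2"
proof -
  have coord: "(cmod (a + b))\<^sup>2 + (cmod (a - b))\<^sup>2 = 2 * (cmod a)\<^sup>2 + 2 * (cmod b)\<^sup>2" for a b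
    by (simp add: cmod_power2) (simp add: power2_eq_square algebra_simps)
  have "(vec_norm (v + w))\<^sup>2 + (vec_norm (v - w))\<^sup>2
      = (\<Sum>i<n. (cmod (v $ i + w $ i))\<^sup>2) + (\<Sum>i<n. (cmod (v $ i - w $ i))\<^sup>2)"
    using assms by (simp add: vec_norm_power2)
  also have "\<dots> = (\<Sum>i<n. 2 * (cmod (v $ i))\<^sup>2 + 2 * (cmod (w $ i))\<^sup>2)"
    unfolding sum.distrib[symmetric] coord ..
  also have "\<dots> = 2 * (\<Sum>i<n. (cmod (v $ i))\<^sup>2) + 2 * (\<Sum>i<n. (cmod (w $ i))\<^sup>2)"
    unfolding sum.distrib sum_distrib_left ..
  also have "\<dots> = 2 * (vec_norm v)\<^sup>2 + 2 * (vec_norm w)\<^sup>2"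
    using assms by (simp add: vec_norm_power2)
  finally show ?thesis .
qed

section \<open>Unitary matrices and the operator norm\<close>

lemma inner_prod_mat_adjoint:
  assumes A: "A \<in> carrier_mat m n" and v: "v \<in> carrier_vec n" and w: "w \<in> carrier_vec m"
  shows "(A *\<^sub>v v) \<bullet>c w = v \<bullet>c (mat_adjoint A *\<^sub>v (w :: complex vec))"
proof -
  have "(A *\<^sub>v v) \<bullet>c w = (\<Sum>i<m. \<Sum>j<n. A $$ (i, j) * v $ j * cnj (w $ i))"
    using assms by (simp add: scalar_prod_def lessThan_atLeast0 sum_distrib_right)
  also have "\<dots> = (\<Sum>j<n. \<Sum>i<m. A $$ (i, j) * v $ j * cnj (w $ i))"
    by (rule sum.swap)
  also have "\<dots> = v \<bullet>c (mat_adjoint A *\<^sub>v w)"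
    using assms
    by (simp add: scalar_prod_def lessThan_atLeast0 sum_distrib_left mat_adjoint_def
        mult.assoc mult.left_commute)
  finally show ?thesis .
qed

lemma mat_adjoint_carrier: "A \<in> carrier_mat m n \<Longrightarrow> mat_adjoint A \<in> carrier_mat n m"
  using mat_of_rows_carrier(1)[of m "map conjugate (cols A)"] by (auto simp: mat_adjoint_def)

lemma unitary_mat_one: "unitary_mat n (1\<^sub>m n)"
proof -
  have "mat_adjoint (1\<^sub>m n) = (1\<^sub>m n :: complex mat)"
    by (rule eq_matI) (auto simp: mat_adjoint_def mat_of_rows_def unit_vec_def)
  then show ?thesis
    by (simp add: unitary_mat_def)
qed

lemma unitary_mat_isometry:
  assumes U: "unitary_mat n U" and v: "v \<in> carrier_vec n"
  shows "vec_norm (U *\<^sub>v v) = vec_norm v"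
proof -
  have Uc: "U \<in> carrier_mat n n" and UU: "mat_adjoint U * U = 1\<^sub>m n"
    using U by (auto simp: unitary_mat_def)
  have Ac: "mat_adjoint U \<in> carrier_mat n n"
    by (rule mat_adjoint_carrier[OF Uc])
  have "mat_adjoint U *\<^sub>v (U *\<^sub>v v) = v"
    using assoc_mult_mat_vec[OF Ac Uc v] v by (simp add: UU)
  then have "(U *\<^sub>v v) \<bullet>c (U *\<^sub>v v) = v \<bullet>c v"
    using inner_prod_mat_adjoint[OF Uc v, of "U *\<^sub>v v"] Uc v by simp
  then show ?thesis
    by (simp add: vec_norm_def)
qed

lemma vec_norm_unitary_diff_le:
  assumes U: "unitary_mat n U" and V: "unitary_mat n V"
    and v: "v \<in> carrier_vec n" and le: "vec_norm v \<le> 1"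
  shows "vec_norm ((U - V) *\<^sub>v v) \<le> 2"
proof -
  have Uc: "U \<in> carrier_mat n n" and Vc: "V \<in> carrier_mat n n"
    using U V by (auto simp: unitary_mat_def)
  have Uv: "U *\<^sub>v v \<in> carrier_vec n" and Vv: "V *\<^sub>v v \<in> carrier_vec n"
    using Uc Vc v by auto
  \<comment> \<open>Drop the square of the norm of the sum from the parallelogram identity for two vectors of
    equal norm.\<close>
  have "(vec_norm (U *\<^sub>v v - V *\<^sub>v v))\<^sup>2 \<le> 4 * (vec_norm v)\<^sup>2"
    using vec_parallelogram[OF Uv Vv] zero_le_power2[of "vec_norm (U *\<^sub>v v + V *\<^sub>v v)"]
    unfolding unitary_mat_isometry[OF U v] unitary_mat_isometry[OF V v] by linarith
  also have "\<dots> \<le> 2\<^sup>2"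
    using power_mono[OF le vec_norm_nonneg, of 2] by simp
  finally have "vec_norm (U *\<^sub>v v - V *\<^sub>v v) \<le> 2"
    by (rule power2_le_imp_le) simp
  then show ?thesis
    by (simp add: minus_mult_distrib_mat_vec[OF Uc Vc v])
qed

lemma op_norm_unitary_diff_le_2:
  assumes "unitary_mat n U" "unitary_mat n V"
  shows "op_norm (U - V) \<le> 2"
proof -
  have "U - V \<in> carrier_mat n n"
    using assms(2) by (intro minus_carrier_mat) (simp add: unitary_mat_def)
  then have dim: "dim_col (U - V) = n"
    by (rule carrier_matD)
  have "0\<^sub>v n \<in> {v \<in> carrier_vec n. vec_norm v \<le> 1}"
    by (simp add: vec_norm_zero)
  then show ?thesis
    unfolding op_norm_def dim using vec_norm_unitary_diff_le[OF assms]
    by (intro cSUP_least) blast+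
qed

lemma op_norm_unitary_self_diff:
  assumes "unitary_mat n U"
  shows "op_norm (U - U) = 0"
proof -
  have U: "U \<in> carrier_mat n n"
    using assms by (auto simp: unitary_mat_def)
  have 0: "vec_norm ((U - U) *\<^sub>v v) = 0" if "v \<in> carrier_vec n" for v
  proof -
    have "U *\<^sub>v v - U *\<^sub>v v = 0\<^sub>v n"
      by (rule minus_cancel_vec[OF mult_mat_vec_carrier[OF U that]])
    then show ?thesis
      by (simp only: minus_mult_distrib_mat_vec[OF U U that] vec_norm_zero)
  qed
  have "op_norm (U - U) = (SUP v\<in>{v \<in> carrier_vec n. vec_norm v \<le> 1}. 0)"
    unfolding op_norm_def using U 0 by (intro SUP_cong) auto
  also have "\<dots> = 0"
    by (rule cSUP_const) (auto intro!: exI[of _ "0\<^sub>v n"] simp: vec_norm_zero)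
  finally show ?thesis .
qed

text \<open>
  A supremum of reals says something about its members only if the set is bounded above. For a
  difference of unitary matrices \<open>vec_norm_unitary_diff_le\<close> supplies the bound \<open>2\<close>.
\<close>

lemma vec_norm_unitary_diff_le_op_norm:
  assumes U: "unitary_mat n U" and V: "unitary_mat n V" and v: "v \<in> carrier_vec n"
  shows "vec_norm ((U - V) *\<^sub>v v) \<le> op_norm (U - V) * vec_norm v"
proof (cases "v = 0\<^sub>v n")
  case True
  have "(U - V) *\<^sub>v 0\<^sub>v n = 0\<^sub>v n"
    using U V by (intro eq_vecI) (auto simp: unitary_mat_def scalar_prod_def)
  then show ?thesis
    using True by (simp add: vec_norm_zero)
next
  case False
  define c where "c = vec_norm v"
  have c: "c > 0"
    using False vec_norm_eq_0_iff[OF v] vec_norm_nonneg[of v] by (simp add: c_def)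
  define w where "w = complex_of_real (inverse c) \<cdot>\<^sub>v v"
  have w: "w \<in> carrier_vec n" "vec_norm w = 1"
    using v c by (simp_all add: w_def vec_norm_smult norm_inverse flip: c_def)
  have carr: "U - V \<in> carrier_mat n n"
    using U V by (auto simp: unitary_mat_def)
  then have "dim_col (U - V) = n"
    by auto
  moreover have "bdd_above ((\<lambda>v. vec_norm ((U - V) *\<^sub>v v)) ` {v \<in> carrier_vec n. vec_norm v \<le> 1})"
    using vec_norm_unitary_diff_le[OF U V] by (intro bdd_aboveI[of _ 2]) auto
  ultimately have "vec_norm ((U - V) *\<^sub>v w) \<le> op_norm (U - V)"
    unfolding op_norm_def using w by (intro cSUP_upper) auto
  moreover have "(U - V) *\<^sub>v w = complex_of_real (inverse c) \<cdot>\<^sub>v ((U - V) *\<^sub>v v)"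
    unfolding w_def using carr v by (rule mult_mat_vec)
  ultimately show ?thesis
    using c by (simp add: vec_norm_smult norm_divide field_simps flip: c_def)
qed

section \<open>Unitary groups have no small subgroups\<close>

lemma vec_diff_add_diff:
  fixes a b c :: "complex vec"
  assumes "a \<in> carrier_vec n" "b \<in> carrier_vec n" "c \<in> carrier_vec n"
  shows "(a - b) + (b - c) = a - c"
  using assms by (intro eq_vecI) auto

lemma minus_one_mult_vec:
  fixes A :: "complex mat"
  assumes "A \<in> carrier_mat n n" "v \<in> carrier_vec n"
  shows "(A - 1\<^sub>m n) *\<^sub>v v = A *\<^sub>v v - v"
  using minus_mult_distrib_mat_vec[OF assms(1) one_carrier_mat assms(2)] assms(2) by simp

text \<open>
  With \<open>w = (U - 1)v\<close> one has \<open>(U\<^sup>2 - 1)v = Uw + w\<close>. The parallelogram law for \<open>Uw\<close> and \<open>w\<close>, which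
  have equal norm, reads \<open>|Uw + w|\<^sup>2 = 4|w|\<^sup>2 - |Uw - w|\<^sup>2\<close>, and the subtracted term is at most
  \<open>|w|\<^sup>2\<close> because \<open>U\<close> is within distance \<open>1\<close> of the identity.
\<close>

lemma unitary_square_displacement:
  assumes U: "unitary_mat n U" and small: "op_norm (U - 1\<^sub>m n) \<le> 1" and v: "v \<in> carrier_vec n"
  shows "3 * (vec_norm ((U - 1\<^sub>m n) *\<^sub>v v))\<^sup>2 \<le> (vec_norm ((U * U - 1\<^sub>m n) *\<^sub>v v))\<^sup>2"
proof -
  have Uc: "U \<in> carrier_mat n n"
    using U by (simp add: unitary_mat_def)
  define w where "w = (U - 1\<^sub>m n) *\<^sub>v v"
  have w_eq: "w = U *\<^sub>v v - v"
    unfolding w_def by (rule minus_one_mult_vec[OF Uc v])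
  have Uv: "U *\<^sub>v v \<in> carrier_vec n"
    by (rule mult_mat_vec_carrier[OF Uc v])
  have UUv: "U *\<^sub>v (U *\<^sub>v v) \<in> carrier_vec n"
    by (rule mult_mat_vec_carrier[OF Uc Uv])
  have w: "w \<in> carrier_vec n"
    unfolding w_eq using Uv v by (rule minus_carrier_vec)
  have Uw: "U *\<^sub>v w \<in> carrier_vec n"
    by (rule mult_mat_vec_carrier[OF Uc w])
  have "(U * U - 1\<^sub>m n) *\<^sub>v v = U *\<^sub>v (U *\<^sub>v v) - v"
    unfolding minus_one_mult_vec[OF mult_carrier_mat[OF Uc Uc] v] assoc_mult_mat_vec[OF Uc Uc v] ..
  also have "\<dots> = (U *\<^sub>v (U *\<^sub>v v) - U *\<^sub>v v) + (U *\<^sub>v v - v)"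
    by (rule vec_diff_add_diff[OF UUv Uv v, symmetric])
  also have "\<dots> = U *\<^sub>v w + w"
    unfolding w_eq mult_minus_distrib_mat_vec[OF Uc Uv v] ..
  finally have sum: "(U * U - 1\<^sub>m n) *\<^sub>v v = U *\<^sub>v w + w" .
  have "vec_norm (U *\<^sub>v w - w) \<le> op_norm (U - 1\<^sub>m n) * vec_norm w"
    using vec_norm_unitary_diff_le_op_norm[OF U unitary_mat_one w]
    unfolding minus_one_mult_vec[OF Uc w] .
  also have "\<dots> \<le> vec_norm w"
    using mult_right_mono[OF small vec_norm_nonneg[of w]] by simp
  finally have "(vec_norm (U *\<^sub>v w - w))\<^sup>2 \<le> (vec_norm w)\<^sup>2"
    by (intro power_mono vec_norm_nonneg)
  then have "3 * (vec_norm w)\<^sup>2 \<le> (vec_norm (U *\<^sub>v w + w))\<^sup>2"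
    using vec_parallelogram[OF Uw w] unfolding unitary_mat_isometry[OF U w] by linarith
  then show ?thesis
    unfolding sum w_def .
qed

text \<open>
  The matrices \<open>U k\<close> are the powers of \<open>U 0\<close> with exponent \<open>2^k\<close>. Each squaring multiplies the
  squared displacement of a vector \<open>v\<close> by at least \<open>3\<close>, while it is always at most \<open>|v|\<^sup>2\<close>; hence the
  displacement is zero.
\<close>

lemma unitary_squaring_orbit_near_one:
  assumes orb: "\<And>k. unitary_mat n (U k)" "\<And>k. U (Suc k) = U k * U k"
    and small: "\<And>k. op_norm (U k - 1\<^sub>m n) \<le> 1"
  shows "U 0 = 1\<^sub>m n"
proof -
  have Uc: "U k \<in> carrier_mat n n" for k
    using orb(1)[of k] by (simp only: unitary_mat_def)
  have fixed: "(U 0 - 1\<^sub>m n) *\<^sub>v v = 0\<^sub>v n" if v: "v \<in> carrier_vec n" for v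
  proof -
    define a where "a = (vec_norm ((U 0 - 1\<^sub>m n) *\<^sub>v v))\<^sup>2"
    have growth: "3 ^ k * a \<le> (vec_norm ((U k - 1\<^sub>m n) *\<^sub>v v))\<^sup>2" for k
    proof (induction k)
      case (Suc k)
      then have "3 ^ Suc k * a \<le> 3 * (vec_norm ((U k - 1\<^sub>m n) *\<^sub>v v))\<^sup>2"
        by simp
      also have "\<dots> \<le> (vec_norm ((U (Suc k) - 1\<^sub>m n) *\<^sub>v v))\<^sup>2"
        using unitary_square_displacement[OF orb(1) small v, of k] by (simp only: orb(2)[of k])
      finally show ?case .
    qed (simp add: a_def)
    have bound: "3 ^ k * a \<le> (vec_norm v)\<^sup>2" for k
    proof -
      have "vec_norm ((U k - 1\<^sub>m n) *\<^sub>v v) \<le> op_norm (U k - 1\<^sub>m n) * vec_norm v"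
        by (rule vec_norm_unitary_diff_le_op_norm[OF orb(1) unitary_mat_one v])
      also have "\<dots> \<le> vec_norm v"
        using mult_right_mono[OF small vec_norm_nonneg[of v]] by simp
      finally have "(vec_norm ((U k - 1\<^sub>m n) *\<^sub>v v))\<^sup>2 \<le> (vec_norm v)\<^sup>2"
        by (intro power_mono vec_norm_nonneg)
      with growth[of k] show ?thesis
        by (rule order_trans)
    qed
    have "a = 0"
    proof (rule ccontr)
      assume "a \<noteq> 0"
      then have "a > 0"
        by (simp add: a_def)
      obtain k where "(vec_norm v)\<^sup>2 / a < 3 ^ k"
        using real_arch_pow[of 3 "(vec_norm v)\<^sup>2 / a"] by auto
      with bound[of k] \<open>a > 0\<close> show False
        by (simp add: field_simps)
    qed
    then have "vec_norm ((U 0 - 1\<^sub>m n) *\<^sub>v v) = 0"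
      by (simp add: a_def)
    moreover have "(U 0 - 1\<^sub>m n) *\<^sub>v v \<in> carrier_vec n"
      by (rule mult_mat_vec_carrier[OF minus_carrier_mat[OF one_carrier_mat] v])
    ultimately show ?thesis
      by (simp only: vec_norm_eq_0_iff)
  qed
  have "col (U 0) j = col (1\<^sub>m n) j" if "j < n" for j
  proof -
    let ?e = "unit_vec n j :: complex vec"
    have "col (U 0) j = U 0 *\<^sub>v ?e"
      using Uc[of 0] that by (intro eq_vecI) auto
    also have "\<dots> = ?e"
    proof (rule eq_vecI)
      fix i assume "i < dim_vec ?e"
      then show "(U 0 *\<^sub>v ?e) $ i = ?e $ i"
        using arg_cong[OF fixed[of ?e], of "\<lambda>x. x $ i"] minus_one_mult_vec[OF Uc[of 0], of ?e]
        by (simp del: index_mult_mat_vec)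
    qed (use Uc[of 0] in simp)
    finally show ?thesis
      using that by simp
  qed
  then show ?thesis
    using Uc[of 0] by (intro mat_col_eqI) auto
qed

section \<open>Balls, representations and levels\<close>

lemma one_ball_eq:
  assumes "group G" "compatible_metric G T d"
  shows "one_ball G d \<eta> = {x \<in> carrier G. d \<one>\<^bsub>G\<^esub> x < \<eta>}"
proof -
  interpret group G by fact
  interpret Metric_space "carrier G" d
    using assms(2) by (simp add: compatible_metric_def)
  show ?thesis
    by (auto simp: one_ball_def mball_def)
qed

text \<open>
  Multiplicativity only makes \<open>\<pi>(1)\<close> idempotent; being unitary, it is also invertible.
\<close>

lemma unitary_rep_one:
  assumes "group G" and rep: "unitary_rep G T n \<pi>"
  shows "\<pi> \<one>\<^bsub>G\<^esub> = 1\<^sub>m n"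
proof -
  interpret group G by fact
  let ?P = "\<pi> \<one>\<^bsub>G\<^esub>"
  have P: "?P \<in> carrier_mat n n" "mat_adjoint ?P \<in> carrier_mat n n"
    and inv: "?P * mat_adjoint ?P = 1\<^sub>m n"
    using rep by (auto simp: unitary_rep_def unitary_mat_def intro: mat_adjoint_carrier)
  have idem: "?P * ?P = ?P"
    using rep unfolding unitary_rep_def by (metis one_closed l_one)
  have "?P = ?P * (?P * mat_adjoint ?P)"
    using P by (simp add: inv)
  also have "\<dots> = ?P * ?P * mat_adjoint ?P"
    using P by (simp add: assoc_mult_mat[of _ n n _ n _ n])
  finally show ?thesis
    by (simp add: idem inv)
qed

lemma subgroup_near_one_in_kernel:
  assumes "group G" and rep: "unitary_rep G T n \<pi>" and H: "subgroup H G"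
    and small: "\<And>x. x \<in> H \<Longrightarrow> op_norm (\<pi> x - 1\<^sub>m n) \<le> 1"
  shows "H \<subseteq> rep_kernel G n \<pi>"
proof
  interpret group G by fact
  fix x assume x: "x \<in> H"
  \<comment> \<open>\<open>y k\<close> is \<open>x\<close> squared \<open>k\<close> times; closure under multiplication keeps it in \<open>H\<close>.\<close>
  define y where "y k = ((\<lambda>z. z \<otimes>\<^bsub>G\<^esub> z) ^^ k) x" for k :: nat
  have yH: "y k \<in> H" for k
    by (induction k) (auto simp: y_def x subgroup.m_closed[OF H])
  have yG: "y k \<in> carrier G" for k
    using yH subgroup.subset[OF H] by auto
  have "\<pi> (y 0) = 1\<^sub>m n"
  proof (rule unitary_squaring_orbit_near_one)
    show "unitary_mat n (\<pi> (y k))" for k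
      using rep yG by (auto simp: unitary_rep_def)
    show "\<pi> (y (Suc k)) = \<pi> (y k) * \<pi> (y k)" for k
      using rep yG[of k] by (auto simp: unitary_rep_def y_def)
    show "op_norm (\<pi> (y k) - 1\<^sub>m n) \<le> 1" for k
      using small yH by auto
  qed
  then show "x \<in> rep_kernel G n \<pi>"
    using yG[of 0] by (simp add: y_def rep_kernel_def)
qed

lemma rep_kernel_eqD:
  assumes "group G" and rep: "unitary_rep G T n \<pi>"
    and x: "x \<in> carrier G" and y: "y \<in> carrier G"
    and ker: "x \<otimes>\<^bsub>G\<^esub> inv\<^bsub>G\<^esub> y \<in> rep_kernel G n \<pi>"
  shows "\<pi> x = \<pi> y"
proof -
  interpret group G by fact
  have "x = x \<otimes>\<^bsub>G\<^esub> inv\<^bsub>G\<^esub> y \<otimes>\<^bsub>G\<^esub> y"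
    using x y by (simp add: m_assoc)
  then have "\<pi> x = \<pi> (x \<otimes>\<^bsub>G\<^esub> inv\<^bsub>G\<^esub> y) * \<pi> y"
    using rep x y unfolding unitary_rep_def by (metis inv_closed m_closed)
  moreover have "\<pi> y \<in> carrier_mat n n"
    using rep y by (auto simp: unitary_rep_def unitary_mat_def)
  ultimately show ?thesis
    using ker by (simp add: rep_kernel_def)
qed

text \<open>
  The radius \<open>1/K\<close> is the largest for which the Lipschitz bound keeps \<open>\<pi>\<close> within distance \<open>1\<close> of the
  identity, and it yields exactly \<open>K\<close> as a bound for the level, so the coefficient does not change.
\<close>

lemma locally_random_imp_metric_quasi_random:
  fixes L :: real
  assumes G: "group G" and d: "compatible_metric G T d"
    and G1: "carrier G = one_ball G d 1"
    and sub: "\<And>\<eta>. 0 < \<eta> \<Longrightarrow> \<eta> \<le> 1 \<Longrightarrow> subgroup (one_ball G d \<eta>) G"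
    and L: "L > 0" and lr: "locally_random G T d L C"
  shows "metric_quasi_random G T d C L"
proof -
  interpret group G by fact
  interpret Metric_space "carrier G" d
    using d by (simp add: compatible_metric_def)
  note ball = one_ball_eq[OF G d]
  have C: "C > 0"
    using lr by (simp add: locally_random_def)
  have sub': "subgroup (one_ball G d \<eta>) G" if "\<eta> > 0" for \<eta>
  proof (cases "\<eta> \<le> 1")
    case False
    have "d \<one>\<^bsub>G\<^esub> x < \<eta>" if "x \<in> carrier G" for x
    proof -
      have "x \<in> one_ball G d 1"
        using that G1 by (rule subst[of _ _ "\<lambda>A. x \<in> A", rotated])
      then show ?thesis
        using False unfolding ball by simp
    qed
    then have "one_ball G d \<eta> = carrier G"
      unfolding ball by blast
    then show ?thesis
      by (simp add: subgroup_self)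
  qed (use sub that in auto)
  have "rep_level G d n \<pi> \<le> ereal (C * real n powr L)"
    if irr: "irreducible_unitary_rep G T n \<pi>" for n \<pi>
  proof -
    define K where "K = C * real n powr L"
    have rep: "unitary_rep G T n \<pi>" and "n > 0"
      using irr by (auto simp: irreducible_unitary_rep_def)
    then have K: "K > 0"
      using C by (simp add: K_def)
    have "one_ball G d (inverse K) \<subseteq> rep_kernel G n \<pi>"
    proof (rule subgroup_near_one_in_kernel[OF G rep])
      show "subgroup (one_ball G d (inverse K)) G"
        using K by (intro sub') simp
      fix x assume x: "x \<in> one_ball G d (inverse K)"
      then have "op_norm (\<pi> x - \<pi> \<one>\<^bsub>G\<^esub>) \<le> K * d x \<one>\<^bsub>G\<^esub>"
        using lr irr by (auto simp: locally_random_def K_def ball)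
      also have "\<dots> \<le> 1"
        using x K by (simp add: ball commute field_simps)
      finally show "op_norm (\<pi> x - 1\<^sub>m n) \<le> 1"
        by (simp add: unitary_rep_one[OF G rep])
    qed
    then have "rep_level G d n \<pi> \<le> ereal (inverse (inverse K))"
      unfolding rep_level_def using K by (intro Inf_lower CollectI exI[of _ "inverse K"]) simp
    then show ?thesis
      by (simp add: K_def)
  qed
  then show ?thesis
    using C L sub' by (simp add: metric_quasi_random_def)
qed

text \<open>
  A bounded level makes \<open>\<pi>\<close> locally constant at scale \<open>1/K\<close>. At larger distances the Lipschitz bound
  is at least \<open>2\<close> and holds for any two unitary matrices.
\<close>

lemma metric_quasi_random_imp_locally_random:
  assumes G: "group G" and d: "compatible_metric G T d" and bi: "bi_invariant G d"
    and mqr: "metric_quasi_random G T d C L"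
  shows "locally_random G T d L (2 * C)"
proof -
  interpret group G by fact
  interpret Metric_space "carrier G" d
    using d by (simp add: compatible_metric_def)
  have C: "C > 0"
    using mqr by (simp add: metric_quasi_random_def)
  have "op_norm (\<pi> x - \<pi> y) \<le> 2 * C * real n powr L * d x y"
    if irr: "irreducible_unitary_rep G T n \<pi>" and x: "x \<in> carrier G" and y: "y \<in> carrier G"
    for n \<pi> x y
  proof -
    define K where "K = C * real n powr L"
    have rep: "unitary_rep G T n \<pi>" and "n > 0"
      using irr by (auto simp: irreducible_unitary_rep_def)
    then have K: "K > 0"
      using C by (simp add: K_def)
    have U: "unitary_mat n (\<pi> x)" "unitary_mat n (\<pi> y)"
      using rep x y by (auto simp: unitary_rep_def)
    have "op_norm (\<pi> x - \<pi> y) \<le> 2 * (K * d x y)"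
    proof (cases "K * d x y < 1")
      case False
      then show ?thesis
        using op_norm_unitary_diff_le_2[OF U] by linarith
    next
      case small: True
      have "\<pi> x = \<pi> y"
      proof (cases "x = y")
        case False
        then have pos: "d x y > 0"
          using x y by simp
        have "rep_level G d n \<pi> \<le> ereal K"
          using mqr irr by (simp add: metric_quasi_random_def K_def)
        also have "ereal K < ereal (inverse (d x y))"
          using small pos by (simp add: field_simps)
        \<comment> \<open>The infimum need not be attained, hence the strict inequality when choosing a radius.\<close>
        finally obtain \<eta> where \<eta>: "\<eta> > 0" "one_ball G d \<eta> \<subseteq> rep_kernel G n \<pi>"
          and lt: "inverse \<eta> < inverse (d x y)"
          unfolding rep_level_def Inf_less_iff by auto
        have "d \<one>\<^bsub>G\<^esub> (x \<otimes>\<^bsub>G\<^esub> inv\<^bsub>G\<^esub> y) = d (y \<otimes>\<^bsub>G\<^esub> inv\<^bsub>G\<^esub> y) (x \<otimes>\<^bsub>G\<^esub> inv\<^bsub>G\<^esub> y)"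
          using y by simp
        also have "\<dots> = d y x"
          using bi x y unfolding bi_invariant_def by blast
        also have "\<dots> = d x y"
          by (rule commute)
        finally have "x \<otimes>\<^bsub>G\<^esub> inv\<^bsub>G\<^esub> y \<in> one_ball G d \<eta>"
          using lt \<eta>(1) pos x y by (simp add: one_ball_eq[OF G d])
        then show ?thesis
          using rep_kernel_eqD[OF G rep x y] \<eta>(2) by auto
      qed simp
      then show ?thesis
        using op_norm_unitary_self_diff[OF U(2)] K nonneg[of x y] by simp
    qed
    then show ?thesis
      by (simp add: K_def mult.assoc)
  qed
  then show ?thesis
    using C by (auto simp: locally_random_def)
qed

theorem proposition5p6:
  fixes G :: "('a, 'b) monoid_scheme" and T :: "'a topology"
    and d :: "'a \<Rightarrow> 'a \<Rightarrow> real" and L :: real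
  assumes "compact_group G T"
    and "compatible_metric G T d"
    and "bi_invariant G d"
    and "carrier G = one_ball G d 1"
    and "\<And>\<eta>. 0 < \<eta> \<Longrightarrow> \<eta> \<le> 1 \<Longrightarrow> subgroup (one_ball G d \<eta>) G"
    and "L \<ge> 1"
  shows "(\<forall>C\<^sub>0. locally_random G T d L C\<^sub>0 \<longrightarrow> metric_quasi_random G T d C\<^sub>0 L) \<and>
         (\<forall>C. metric_quasi_random G T d C L \<longrightarrow> locally_random G T d L (2 * C))"
proof -
  have G: "group G"
    using assms(1) by (simp add: compact_group_def topological_group_def)
  have "L > 0"
    using assms(6) by simp
  then show ?thesis
    using locally_random_imp_metric_quasi_random[OF G assms(2,4,5)]
      metric_quasi_random_imp_locally_random[OF G assms(2,3)] by blast
qed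

end
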